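(* Let $b,c$ be positive integers with $g=\gcd(b,c)\ge 2$ and $\frac{b+c}{g}=4^l$ for a positive integer $l$. Then: 1. For all nonnegative integers $m,n$ with $2m+n=\frac{g(4^l-1)}{3}$ there is a perfect coloring of $D(m,n)$ with quotient matrix $\begin{pmatrix} c-g & b\\ c & b-g\end{pmatrix}$. 2. If $g$ is odd, then for $m$ with $2m=\frac{g(4^l-1)+3}{3}$ there is a perfect coloring of $D(m,0)$ with quotient matrix $\begin{pmatrix} c-g+3 & b\\ c & b-g+3\end{pmatrix}$.
   Context: The Shrikhande graph is the Cayley graph on $\mathbb{Z}_4^2$ with connection set $\{01,03,10,30,11,33\}$. For nonnegative integers $m,n$, $D(m,n)$ is the Cartesian product of $m$ copies of the Shrikhande graph and $n$ copies of $K_4$ (vertex set $(\mathbb{Z}_4^2)^m\times\mathbb{Z}_4^n$; adjacent iff differing in exactly one coordinate by an adjacency of that factor). A $2$-coloring (surjective map onto colors $\{1,2\}$) is perfect with quotient matrix $(s_{ij})$ if every vertex of color $i$ has exactly $s_{ij}$ neighbours of color $j$. *)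

theory Defs
  imports "HOL-Analysis.Cartesian_Space" "HOL-Library.Numeral_Type" "HOL-Library.Product_Plus"
begin

(* The numeral type 4 is the ring Z/4Z, and 4 \<times> 4 carries the componentwise group structure. *)

definition cayley_adj :: "'a::ab_group_add set \<Rightarrow> 'a \<Rightarrow> 'a \<Rightarrow> bool" where
  "cayley_adj S x y \<longleftrightarrow> y - x \<in> S"

definition shrikhande_adj :: "4 \<times> 4 \<Rightarrow> 4 \<times> 4 \<Rightarrow> bool" where
  "shrikhande_adj = cayley_adj {(0,1), (0,3), (1,0), (3,0), (1,1), (3,3)}"

definition complete_adj :: "'a \<Rightarrow> 'a \<Rightarrow> bool" where
  "complete_adj x y \<longleftrightarrow> x \<noteq> y"

definition cart_power_adj :: "('a \<Rightarrow> 'a \<Rightarrow> bool) \<Rightarrow> 'a list \<Rightarrow> 'a list \<Rightarrow> bool" where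
  "cart_power_adj adj xs ys \<longleftrightarrow> length xs = length ys \<and>
     (\<exists>i<length xs. adj (xs ! i) (ys ! i) \<and> (\<forall>j<length xs. j \<noteq> i \<longrightarrow> xs ! j = ys ! j))"

definition D_verts :: "nat \<Rightarrow> nat \<Rightarrow> ((4 \<times> 4) list \<times> 4 list) set" where
  "D_verts m n = {xs. length xs = m} \<times> {ys. length ys = n}"

definition D_adj :: "(4 \<times> 4) list \<times> 4 list \<Rightarrow> (4 \<times> 4) list \<times> 4 list \<Rightarrow> bool" where
  "D_adj u v \<longleftrightarrow>
     cart_power_adj shrikhande_adj (fst u) (fst v) \<and> snd u = snd v \<or>
     fst u = fst v \<and> cart_power_adj complete_adj (snd u) (snd v)"

(* Colors are the elements of a finite type 'k, so that they index the rows and columns of the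
   quotient matrix S: row = color of the vertex, column = color of the neighbour.
   For 'k = 2 the two colors are 1 and 2. *)
definition perfect_coloring ::
  "'v set \<Rightarrow> ('v \<Rightarrow> 'v \<Rightarrow> bool) \<Rightarrow> int ^ 'k ^ 'k \<Rightarrow> ('v \<Rightarrow> 'k) \<Rightarrow> bool" where
  "perfect_coloring V adj S f \<longleftrightarrow> f ` V = UNIV \<and>
     (\<forall>v\<in>V. \<forall>j. int (card {w \<in> V. adj v w \<and> f w = j}) = S $ f v $ j)"

end

theory Submission
  imports Defs "HOL-Library.Function_Algebras"
begin

text \<open>
  Put $N = (4^l - 1)/3$. It suffices to color the vertices by $4^l$ colors so that each vertex has
  exactly $g$ neighbours of every other color and $s$ of its own ($s = 0$ or $3$): merging $c/g$
  of the colors gives the perfect coloring. If the colors form a group, sums of such colorings on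
  the factors are again such colorings, and a homomorphism from a factor contributes the image of
  the connection set, so one has to cover the nonzero group elements $g$ times.

  The number of colors is multiplied by 4 by covering $C \setminus B$ for a subgroup $B$ of
  index 4. In $\mathbb{F}_4^{l+1} \setminus \mathbb{F}_4^l$ the lines over $\mathbb{F}_4$ do
  this: $K_4$ covers a line once and the Shrikhande graph covers it twice. In
  $\mathbb{Z}_4^2 \times \mathbb{F}_4^k$ the elements of order 4 are covered by Shrikhande
  graphs alone, which leaves only one $K_4$ in the case $g = 1$. Adding this coloring to the
  line coloring for $g - 1$ handles odd $g$. For the second part the last $K_4$, together with one
  Shrikhande graph, is replaced by two Shrikhande graphs carrying a nonlinear 4-coloring in which
  every vertex has 3 neighbours of each color.
\<close>

section \<open>Finite case checks and adjacency in Cartesian powers\<close>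

text \<open>Unfolding with this equation turns claims about Z_4 into finitely many ground
  evaluations. \<open>exhaust_4\<close> lists the representatives 1 to 4, hence the rewriting of 4
  to 0.\<close>

lemma all_4: "(\<forall>x::4. P x) \<longleftrightarrow> P 0 \<and> P 1 \<and> P 2 \<and> P 3"
proof -
  have "(4::4) = 0" by simp
  then show ?thesis using exhaust_4 by metis
qed

lemma all_2: "(\<forall>x::2. P x) \<longleftrightarrow> P 0 \<and> P 1"
proof -
  have "(2::2) = 0" by simp
  then show ?thesis using exhaust_2 by metis
qed

lemma cart_power_adj_Nil [simp]: "\<not> cart_power_adj adj [] ys"
  by (simp add: cart_power_adj_def)

lemma cart_power_adj_Cons:
  "cart_power_adj adj (x # xs) (y # ys) \<longleftrightarrow>
     length xs = length ys \<and> (adj x y \<and> xs = ys \<or> x = y \<and> cart_power_adj adj xs ys)"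
proof
  assume "cart_power_adj adj (x # xs) (y # ys)"
  then obtain i where len: "length xs = length ys" and i: "i < Suc (length xs)"
    and a: "adj ((x # xs) ! i) ((y # ys) ! i)"
    and e: "\<And>j. j < Suc (length xs) \<Longrightarrow> j \<noteq> i \<Longrightarrow> (x # xs) ! j = (y # ys) ! j"
    by (auto simp: cart_power_adj_def)
  show "length xs = length ys \<and> (adj x y \<and> xs = ys \<or> x = y \<and> cart_power_adj adj xs ys)"
  proof (cases i)
    case 0
    have "xs = ys"
      using e[of "Suc _"] len 0 by (intro nth_equalityI) auto
    with a 0 len show ?thesis by simp
  next
    case (Suc k)
    have "x = y" using e[of 0] Suc by simp
    moreover have "cart_power_adj adj xs ys"
      unfolding cart_power_adj_def using len i a Suc e[of "Suc _"] by auto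
    ultimately show ?thesis using len by simp
  qed
next
  assume "length xs = length ys \<and> (adj x y \<and> xs = ys \<or> x = y \<and> cart_power_adj adj xs ys)"
  then consider "adj x y" "xs = ys" | "x = y" "cart_power_adj adj xs ys"
    by blast
  then show "cart_power_adj adj (x # xs) (y # ys)"
  proof cases
    case 1
    then show ?thesis
      unfolding cart_power_adj_def by (auto intro!: exI[of _ 0] simp: nth_Cons split: nat.split)
  next
    case 2
    then obtain i where "i < length xs" "adj (xs ! i) (ys ! i)" "length xs = length ys"
      "\<forall>j<length xs. j \<noteq> i \<longrightarrow> xs ! j = ys ! j"
      by (auto simp: cart_power_adj_def)
    then show ?thesis
      unfolding cart_power_adj_def using \<open>x = y\<close>
      by (auto intro!: exI[of _ "Suc i"] simp: nth_Cons split: nat.split)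
  qed
qed

lemma cart_power_adj_length: "cart_power_adj adj xs ys \<Longrightarrow> length xs = length ys"
  by (simp add: cart_power_adj_def)

lemma cart_power_adj_append:
  assumes "length xs = length xs'" and "length ys = length ys'"
  shows "cart_power_adj adj (xs @ ys) (xs' @ ys') \<longleftrightarrow>
     cart_power_adj adj xs xs' \<and> ys = ys' \<or> xs = xs' \<and> cart_power_adj adj ys ys'"
  using assms by (induction xs xs' rule: list_induct2) (auto simp: cart_power_adj_Cons)

lemma cart_power_adj_singleton: "cart_power_adj adj [x] [y] \<longleftrightarrow> adj x y"
  by (simp add: cart_power_adj_Cons)

lemma cart_power_adj_irrefl: "(\<And>x. \<not> adj x x) \<Longrightarrow> \<not> cart_power_adj adj xs xs"
  by (simp add: cart_power_adj_def)

lemma shrikhande_adj_irrefl: "\<not> shrikhande_adj x x"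
  by (simp add: shrikhande_adj_def cayley_adj_def zero_prod_def)

lemma D_adj_irrefl: "\<not> D_adj v v"
  by (simp add: D_adj_def cart_power_adj_irrefl shrikhande_adj_irrefl complete_adj_def)

text \<open>Adjacency forces equal lengths, so \<open>D_verts m n\<close> is closed under it in both
  directions. Neighbours can therefore be counted among all pairs of lists.\<close>

lemma D_adj_verts: "D_adj v w \<Longrightarrow> w \<in> D_verts m n \<longleftrightarrow> v \<in> D_verts m n"
  by (cases v; cases w) (auto simp: D_adj_def D_verts_def dest: cart_power_adj_length)

lemma finite_D_verts: "finite (D_verts m n)"
  using finite_lists_length_eq[of "UNIV :: (4 \<times> 4) set" m]
    finite_lists_length_eq[of "UNIV :: 4 set" n]
  by (simp add: D_verts_def)

lemma D_verts_nonempty: "D_verts m n \<noteq> {}"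
proof -
  have "(replicate m 0, replicate n 0) \<in> D_verts m n"
    by (simp add: D_verts_def)
  then show ?thesis by blast
qed

lemma finite_D_adj: "finite {w. D_adj v w \<and> P w}"
proof -
  obtain m n where "v \<in> D_verts m n"
    by (cases v) (auto simp: D_verts_def)
  then have "{w. D_adj v w \<and> P w} \<subseteq> D_verts m n"
    using D_adj_verts by blast
  then show ?thesis using finite_D_verts finite_subset by blast
qed

section \<open>D(m + m', n + n') as a Cartesian product\<close>

definition join where
  "join v w = (fst v @ fst w, snd v @ snd w)"

lemma D_adj_join:
  assumes "v \<in> D_verts m n" "v' \<in> D_verts m n" "w \<in> D_verts m' n'" "w' \<in> D_verts m' n'"
  shows "D_adj (join v w) (join v' w') \<longleftrightarrow> D_adj v v' \<and> w = w' \<or> v = v' \<and> D_adj w w'"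
  using assms
  by (cases v; cases v'; cases w; cases w')
    (auto simp: D_adj_def join_def D_verts_def cart_power_adj_append)

lemma join_exhaust:
  assumes "u \<in> D_verts (m + m') (n + n')"
  obtains v w where "v \<in> D_verts m n" "w \<in> D_verts m' n'" "u = join v w"
proof
  show "(take m (fst u), take n (snd u)) \<in> D_verts m n"
    "(drop m (fst u), drop n (snd u)) \<in> D_verts m' n'"
    "u = join (take m (fst u), take n (snd u)) (drop m (fst u), drop n (snd u))"
    using assms by (auto simp: D_verts_def join_def)
qed

lemma inj_join:
  assumes "v \<in> D_verts m n" "v' \<in> D_verts m n" "join v w = join v' w'"
  shows "v = v' \<and> w = w'"
  using assms by (cases v; cases v'; cases w; cases w') (auto simp: join_def D_verts_def)

lemma join_in_D_verts:
  assumes "v \<in> D_verts m n" "w \<in> D_verts m' n'"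
  shows "join v w \<in> D_verts (m + m') (n + n')"
  using assms by (auto simp: D_verts_def join_def)

text \<open>A neighbour of a joined vertex changes exactly one of the two parts. The two kinds of
  neighbours are disjoint because no vertex is adjacent to itself.\<close>

lemma card_D_adj_join:
  assumes v: "v \<in> D_verts m n" and w: "w \<in> D_verts m' n'"
  shows "card {u. D_adj (join v w) u \<and> P u} =
    card {v'. D_adj v v' \<and> P (join v' w)} + card {w'. D_adj w w' \<and> P (join v w')}"
proof -
  let ?A = "{v'. D_adj v v' \<and> P (join v' w)}" and ?B = "{w'. D_adj w w' \<and> P (join v w')}"
  have A: "?A \<subseteq> D_verts m n" and B: "?B \<subseteq> D_verts m' n'"
    using v w D_adj_verts by blast+
  have "{u. D_adj (join v w) u \<and> P u} = (\<lambda>v'. join v' w) ` ?A \<union> (\<lambda>w'. join v w') ` ?B"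
    (is "?L = ?R")
  proof
    show "?L \<subseteq> ?R"
    proof
      fix u assume u: "u \<in> ?L"
      then have "u \<in> D_verts (m + m') (n + n')"
        using D_adj_verts join_in_D_verts[OF v w] by blast
      then obtain v' w' where "v' \<in> D_verts m n" "w' \<in> D_verts m' n'" "u = join v' w'"
        by (rule join_exhaust)
      with u show "u \<in> ?R" using D_adj_join[OF v _ w] by auto
    qed
    show "?R \<subseteq> ?L"
    proof
      fix u assume "u \<in> ?R"
      then consider v' where "v' \<in> ?A" "u = join v' w" | w' where "w' \<in> ?B" "u = join v w'"
        by blast
      then show "u \<in> ?L"
      proof cases
        case 1
        then show ?thesis using D_adj_join[OF v _ w w] A by blast
      next
        case 2
        then show ?thesis using D_adj_join[OF v v w] B by blast
      qed
    qed
  qed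
  moreover have "(\<lambda>v'. join v' w) ` ?A \<inter> (\<lambda>w'. join v w') ` ?B = {}"
    using inj_join[OF _ v] A D_adj_irrefl by blast
  moreover have "inj_on (\<lambda>v'. join v' w) ?A" "inj_on (\<lambda>w'. join v w') ?B"
    using inj_join A v unfolding inj_on_def by blast+
  ultimately show ?thesis
    by (simp add: card_Un_disjoint finite_D_adj card_image)
qed

section \<open>Neighbour counts in a single factor\<close>

definition shrikhande_conn :: "(4 \<times> 4) set" where
  "shrikhande_conn = {(0,1), (0,3), (1,0), (3,0), (1,1), (3,3)}"

lemma shrikhande_adj_iff: "shrikhande_adj x y \<longleftrightarrow> y - x \<in> shrikhande_conn"
  by (simp add: shrikhande_adj_def shrikhande_conn_def cayley_adj_def)

lemma card_D_adj_Shrikhande: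
  "card {u. D_adj ([x], []) u \<and> P u} =
     card {s \<in> shrikhande_conn. P ([x + s], [])}"
proof -
  have "{u. D_adj ([x], []) u \<and> P u} =
    (\<lambda>s. ([x + s], [])) ` {s \<in> shrikhande_conn. P ([x + s], [])}"
    (is "?L = ?R")
  proof
    show "?L \<subseteq> ?R"
    proof
      fix u assume u: "u \<in> ?L"
      then have "u \<in> D_verts 1 0"
        using D_adj_verts[of "([x], [])" u 1 0] by (simp add: D_verts_def)
      then obtain y where y: "u = ([y], [])"
        by (cases u) (auto simp: D_verts_def length_Suc_conv)
      have "u = ([x + (y - x)], [])" using y by simp
      moreover have "y - x \<in> shrikhande_conn"
        using u y by (simp add: D_adj_def cart_power_adj_singleton shrikhande_adj_iff)
      ultimately show "u \<in> ?R"
        using u by blast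
    qed
    show "?R \<subseteq> ?L"
      by (auto simp: D_adj_def cart_power_adj_singleton shrikhande_adj_iff)
  qed
  then show ?thesis
    by (simp add: card_image inj_on_def)
qed

lemma card_D_adj_complete:
  "card {u. D_adj ([], [x]) u \<and> P u} = card {y. y \<noteq> x \<and> P ([], [y])}"
proof -
  have "{u. D_adj ([], [x]) u \<and> P u} = (\<lambda>y. ([], [y])) ` {y. y \<noteq> x \<and> P ([], [y])}"
    (is "?L = ?R")
  proof
    show "?L \<subseteq> ?R"
    proof
      fix u assume u: "u \<in> ?L"
      then have "u \<in> D_verts 0 1"
        using D_adj_verts[of "([], [x])" u 0 1] by (simp add: D_verts_def)
      then obtain y where y: "u = ([], [y])"
        by (cases u) (auto simp: D_verts_def length_Suc_conv)
      then show "u \<in> ?R"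
        using u by (auto simp: D_adj_def cart_power_adj_singleton complete_adj_def)
    qed
    show "?R \<subseteq> ?L"
      by (auto simp: D_adj_def cart_power_adj_singleton complete_adj_def)
  qed
  then show ?thesis
    by (simp add: card_image inj_on_def)
qed

section \<open>Colorings by elements of an abelian group\<close>

definition finite_subgroup :: "'a::ab_group_add set \<Rightarrow> bool" where
  "finite_subgroup C \<longleftrightarrow> finite C \<and> 0 \<in> C \<and> (\<forall>x\<in>C. \<forall>y\<in>C. x + y \<in> C) \<and> (\<forall>x\<in>C. - x \<in> C)"

text \<open>
  The number of neighbours of color $j$ depends only on the difference to the own color: the
  coloring behaves like a homomorphism into $C$ with image multiset $\mu$ of the connection set.
\<close>
definition diff_colorable :: "'a::ab_group_add set \<Rightarrow> ('a \<Rightarrow> nat) \<Rightarrow> nat \<Rightarrow> nat \<Rightarrow> bool" where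
  "diff_colorable C \<mu> m n \<longleftrightarrow> (\<exists>f. \<forall>v\<in>D_verts m n. f v \<in> C \<and>
     (\<forall>j. card {w. D_adj v w \<and> f w = j} = \<mu> (j - f v)))"

text \<open>The quotient matrix with \<open>s\<close> on the diagonal and \<open>g\<close> elsewhere
  is invariant under all permutations of the colors. So the colors carry no group structure here and
  may be identified with the elements of any group of order \<open>k\<close>.\<close>

definition balanced_colorable :: "nat \<Rightarrow> nat \<Rightarrow> nat \<Rightarrow> nat \<Rightarrow> nat \<Rightarrow> bool" where
  "balanced_colorable k s g m n \<longleftrightarrow> (\<exists>f. \<forall>v\<in>D_verts m n. f v < k \<and>
     (\<forall>j<k. card {w. D_adj v w \<and> f w = j} = (if j = f v then s else g)))"

text \<open>The color of a joined vertex is the sum of the colors of its parts. Moving in one part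
  changes the sum by the change of that part's color, so the counts for a given difference add
  up.\<close>

lemma diff_colorable_sum:
  assumes "finite_subgroup C" "diff_colorable C \<mu> m n" "diff_colorable C \<mu>' m' n'"
  shows "diff_colorable C (\<lambda>a. \<mu> a + \<mu>' a) (m + m') (n + n')"
proof -
  obtain f where f: "\<And>v. v \<in> D_verts m n \<Longrightarrow> f v \<in> C"
    "\<And>v j. v \<in> D_verts m n \<Longrightarrow> card {w. D_adj v w \<and> f w = j} = \<mu> (j - f v)"
    using assms unfolding diff_colorable_def by fast
  obtain f' where f': "\<And>v. v \<in> D_verts m' n' \<Longrightarrow> f' v \<in> C"
    "\<And>v j. v \<in> D_verts m' n' \<Longrightarrow> card {w. D_adj v w \<and> f' w = j} = \<mu>' (j - f' v)"
    using assms unfolding diff_colorable_def by fast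
  define F where "F u = f (take m (fst u), take n (snd u)) + f' (drop m (fst u), drop n (snd u))"
    for u
  have F: "F (join v w) = f v + f' w" if "v \<in> D_verts m n" for v w
    using that by (auto simp: F_def join_def D_verts_def)
  show ?thesis
    unfolding diff_colorable_def
  proof (intro exI[of _ F] ballI)
    fix u assume "u \<in> D_verts (m + m') (n + n')"
    then obtain v w where vw: "v \<in> D_verts m n" "w \<in> D_verts m' n'" and u: "u = join v w"
      by (rule join_exhaust)
    have "card {x. D_adj u x \<and> F x = j} = \<mu> (j - F u) + \<mu>' (j - F u)" for j
    proof -
      have "{v'. D_adj v v' \<and> F (join v' w) = j} = {v'. D_adj v v' \<and> f v' = j - f' w}"
        using F[of _ w] D_adj_verts[of v _ m n] vw by (auto simp: eq_diff_eq)
      moreover have "{w'. D_adj w w' \<and> F (join v w') = j} = {w'. D_adj w w' \<and> f' w' = j - f v}"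
        using F[OF vw(1)] by (simp add: eq_diff_eq add.commute)
      ultimately show ?thesis
        unfolding u card_D_adj_join[OF vw] F[OF vw(1)]
        by (simp add: f(2)[OF vw(1)] f'(2)[OF vw(2)] diff_diff_eq add.commute)
    qed
    then show "F u \<in> C \<and> (\<forall>j. card {x. D_adj u x \<and> F x = j} = \<mu> (j - F u) + \<mu>' (j - F u))"
      using f(1)[OF vw(1)] f'(1)[OF vw(2)] F[OF vw(1)] u assms(1) by (simp add: finite_subgroup_def)
  qed
qed

lemma D_verts_0: "D_verts 0 0 = {([], [])}"
  by (auto simp: D_verts_def)

lemma D_adj_Nil: "\<not> D_adj ([], []) w"
  by (simp add: D_adj_def)

lemma diff_colorable_zero: "finite_subgroup C \<Longrightarrow> diff_colorable C (\<lambda>_. 0) 0 0"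
  by (auto simp: diff_colorable_def D_verts_0 D_adj_Nil finite_subgroup_def
      intro!: exI[of _ "\<lambda>_. 0"])

lemma diff_colorable_sum_set:
  assumes "finite_subgroup C" "finite I" "\<And>i. i \<in> I \<Longrightarrow> diff_colorable C (\<mu> i) (M i) (N i)"
  shows "diff_colorable C (\<lambda>a. \<Sum>i\<in>I. \<mu> i a) (\<Sum>i\<in>I. M i) (\<Sum>i\<in>I. N i)"
  using assms(2,3)
proof (induction I rule: finite_induct)
  case empty
  then show ?case using diff_colorable_zero[OF assms(1)] by simp
next
  case (insert i I)
  then show ?case
    using diff_colorable_sum[OF assms(1), of "\<mu> i" "M i" "N i" "\<lambda>a. \<Sum>i\<in>I. \<mu> i a"] by simp
qed

lemma diff_colorable_mult:
  assumes "finite_subgroup C" "diff_colorable C \<mu> m n"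
  shows "diff_colorable C (\<lambda>a. k * \<mu> a) (k * m) (k * n)"
  using diff_colorable_sum_set[OF assms(1), of "{..<k}" "\<lambda>_. \<mu>" "\<lambda>_. m" "\<lambda>_. n"] assms(2) by simp

text \<open>The neighbour \<open>x + s\<close> of \<open>x\<close> has color
  \<open>h x + h s\<close>, so the differences are the images of the connection set.\<close>

lemma diff_colorable_Shrikhande:
  assumes "\<And>x y. h (x + y) = h x + h y" "\<And>x. h x \<in> C"
  shows "diff_colorable C (\<lambda>a. card {s \<in> shrikhande_conn. h s = a}) 1 0"
  unfolding diff_colorable_def
proof (intro exI[of _ "\<lambda>u. h (hd (fst u))"] ballI conjI allI)
  fix v :: "(4 \<times> 4) list \<times> 4 list" and j assume "v \<in> D_verts 1 0"
  then obtain x where v: "v = ([x], [])"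
    by (cases v) (auto simp: D_verts_def length_Suc_conv)
  show "card {w. D_adj v w \<and> h (hd (fst w)) = j} =
    card {s \<in> shrikhande_conn. h s = j - h (hd (fst v))}"
    unfolding v card_D_adj_Shrikhande
    by (simp add: assms(1) eq_diff_eq add.commute)
qed (use assms in auto)

text \<open>The elements of Z_4 serve only as names of the four vertices of K_4; the group used on
  them is the Klein four-group, not Z_4.\<close>

definition klein :: "'a::ab_group_add \<Rightarrow> 'a \<Rightarrow> 4 \<Rightarrow> 'a" where
  "klein x y t = (if t = 0 then 0 else if t = 1 then x else if t = 2 then y else x + y)"

text \<open>K_4 is the Cayley graph of the Klein four-group with respect to its three nonzero
  elements, which are sent to \<open>x\<close>, \<open>y\<close> and \<open>x + y\<close>.\<close>

lemma diff_colorable_complete: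
  assumes "finite_subgroup C" "x \<in> C" "y \<in> C" "x + x = 0" "y + y = 0"
  shows "diff_colorable C (\<lambda>a. of_bool (a = x) + of_bool (a = y) + of_bool (a = x + y)) 0 1"
proof -
  have x: "- x = x" "- y = y"
    using assms by (simp_all add: neg_eq_iff_add_eq_0)
  show ?thesis
  unfolding diff_colorable_def
  proof (intro exI[of _ "\<lambda>u. klein x y (hd (snd u))"] ballI conjI allI)
    fix v :: "(4 \<times> 4) list \<times> 4 list" and j assume "v \<in> D_verts 0 1"
    then obtain t where v: "v = ([], [t])"
      by (cases v) (auto simp: D_verts_def length_Suc_conv)
    have D: "card {t'. t' \<noteq> t \<and> klein x y t' = j} =
        (\<Sum>t'\<in>UNIV. of_bool (t' \<noteq> t \<and> klein x y t' = j))"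
      by (simp add: Groups_Big.sum_of_bool_eq)
    have U: "(UNIV :: 4 set) = {0, 1, 2, 3}"
      using all_4[of "\<lambda>x. x \<in> {0, 1, 2, 3}"] by auto
    have xx: "x + (x + z) = z" "y + (y + z) = z" for z
      using assms by (simp_all flip: add.assoc)
    have eq: "z = j \<longleftrightarrow> j = z" for z
      by auto
    have *: "\<forall>t. (\<Sum>t'\<in>UNIV. of_bool (t' \<noteq> t \<and> klein x y t' = j)) =
      of_bool (j - klein x y t = x) + of_bool (j - klein x y t = y) +
      (of_bool (j - klein x y t = x + y) :: nat)"
      unfolding all_4 U klein_def using assms(4,5)
      by (simp add: diff_eq_eq xx eq ac_simps)
    then show "card {w. D_adj v w \<and> klein x y (hd (snd w)) = j} =
      of_bool (j - klein x y (hd (snd v)) = x) + of_bool (j - klein x y (hd (snd v)) = y) +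
      of_bool (j - klein x y (hd (snd v)) = x + y)"
      unfolding v card_D_adj_complete using D by simp
  qed (use assms in \<open>auto simp: klein_def finite_subgroup_def\<close>)
qed

section \<open>Passing between balanced colorings and group colorings\<close>

text \<open>Any bijection of the colors with \<open>B\<close> works, since only equality of colors
  matters for the counts; the given coloring need not come from a homomorphism. All colors stay in
  \<open>B\<close>, so differences outside \<open>B\<close> never occur.\<close>

lemma balanced_imp_diff_colorable:
  assumes "finite_subgroup B" "balanced_colorable (card B) s g m n" "B \<subseteq> C"
  shows "diff_colorable C (\<lambda>a. if a = 0 then s else if a \<in> B then g else 0) m n"
proof -
  obtain h where h: "bij_betw h {..<card B} B"
    using assms unfolding finite_subgroup_def by (metis atLeast0LessThan ex_bij_betw_nat_finite)
  obtain f where f: "\<And>v. v \<in> D_verts m n \<Longrightarrow> f v < card B"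
    "\<And>v j. v \<in> D_verts m n \<Longrightarrow> j < card B \<Longrightarrow>
       card {w. D_adj v w \<and> f w = j} = (if j = f v then s else g)"
    using assms unfolding balanced_colorable_def by fast
  have fB: "h (f v) \<in> B" if "v \<in> D_verts m n" for v
    using f(1)[OF that] h by (auto simp: bij_betw_def)
  show ?thesis unfolding diff_colorable_def
  proof (intro exI[of _ "h \<circ> f"] ballI conjI allI)
    fix v j assume v: "v \<in> D_verts m n"
    show "(h \<circ> f) v \<in> C" using fB[OF v] assms by auto
    have B: "j - h (f v) \<in> B \<longleftrightarrow> j \<in> B"
    proof
      assume "j - h (f v) \<in> B"
      then have "(j - h (f v)) + h (f v) \<in> B"
        using assms(1) fB[OF v] unfolding finite_subgroup_def by blast
      then show "j \<in> B" by simp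
    next
      assume "j \<in> B"
      then have "j + - h (f v) \<in> B"
        using assms(1) fB[OF v] unfolding finite_subgroup_def by blast
      then show "j - h (f v) \<in> B" by simp
    qed
    show "card {w. D_adj v w \<and> (h \<circ> f) w = j} =
      (if j - (h \<circ> f) v = 0 then s else if j - (h \<circ> f) v \<in> B then g else 0)"
    proof (cases "j \<in> B")
      case True
      then obtain i where i: "i < card B" "j = h i"
        using h by (auto simp: bij_betw_def)
      have "h i' = h i \<longleftrightarrow> i' = i" if "i' < card B" for i'
        using h i that by (auto simp: bij_betw_def inj_on_def)
      then have "{w. D_adj v w \<and> (h \<circ> f) w = j} = {w. D_adj v w \<and> f w = i}"
        "h i = h (f v) \<longleftrightarrow> i = f v"
        using f(1) D_adj_verts[of v _ m n] v i by (auto, metis)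
      then show ?thesis using f(2)[OF v i(1)] True B i by (auto simp: )
    next
      case False
      then have *: "{w. D_adj v w \<and> (h \<circ> f) w = j} = {}"
        using fB D_adj_verts[of v _ m n] v by auto
      have "j \<noteq> h (f v)" using False fB[OF v] by auto
      then show ?thesis unfolding * using B False by simp
    qed
  qed
qed

lemma diff_imp_balanced_colorable:
  assumes "finite_subgroup C" "diff_colorable C \<mu> m n" "\<mu> 0 = s" "\<And>a. a \<in> C \<Longrightarrow> a \<noteq> 0 \<Longrightarrow> \<mu> a = g"
  shows "balanced_colorable (card C) s g m n"
proof -
  obtain h where h: "bij_betw h C {..<card C}"
    using assms unfolding finite_subgroup_def by (metis atLeast0LessThan ex_bij_betw_finite_nat)
  obtain f where f: "\<And>v. v \<in> D_verts m n \<Longrightarrow> f v \<in> C"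
    "\<And>v j. v \<in> D_verts m n \<Longrightarrow> card {w. D_adj v w \<and> f w = j} = \<mu> (j - f v)"
    using assms unfolding diff_colorable_def by fast
  show ?thesis unfolding balanced_colorable_def
  proof (intro exI[of _ "h \<circ> f"] ballI conjI allI impI)
    fix v j assume v: "v \<in> D_verts m n"
    show "(h \<circ> f) v < card C" using f(1)[OF v] h by (auto simp: bij_betw_def)
    assume "j < card C"
    then obtain i where i: "i \<in> C" "j = h i"
      using h unfolding bij_betw_def by (metis imageE lessThan_iff)
    have hh: "h i' = h i \<longleftrightarrow> i' = i" if "i' \<in> C" for i'
      using h i that by (auto simp: bij_betw_def inj_on_def)
    then have "{w. D_adj v w \<and> (h \<circ> f) w = j} = {w. D_adj v w \<and> f w = i}"
      using f(1) D_adj_verts[of v _ m n] v i by auto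
    moreover have "i + - f v \<in> C"
      using assms(1) i f(1)[OF v] unfolding finite_subgroup_def by blast
    ultimately show "card {w. D_adj v w \<and> (h \<circ> f) w = j} = (if j = (h \<circ> f) v then s else g)"
      using f(2)[OF v] i hh[OF f(1)[OF v]] assms(3,4)
      by (cases "i = f v") auto
  qed
qed

text \<open>The inductive step: the old coloring supplies the differences in \<open>B\<close>, the
  new factors those in \<open>C\<close> outside \<open>B\<close>, so every nonzero element of
  \<open>C\<close> occurs \<open>g\<close> times. The diagonal entry stays \<open>s\<close> because
  \<open>0\<close> lies in \<open>B\<close>.\<close>

lemma balanced_colorable_extend:
  assumes "finite_subgroup C" "finite_subgroup B" "B \<subseteq> C" "balanced_colorable (card B) s g m n"
    "diff_colorable C \<mu> m' n'" "\<And>a. a \<in> C \<Longrightarrow> \<mu> a = (if a \<in> B then 0 else g)"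
  shows "balanced_colorable (card C) s g (m + m') (n + n')"
proof -
  have "0 \<in> B" "0 \<in> C" using assms unfolding finite_subgroup_def by auto
  then show ?thesis
    using diff_imp_balanced_colorable[OF assms(1)
        diff_colorable_sum[OF assms(1) balanced_imp_diff_colorable[OF assms(2,4,3)] assms(5)]] assms(6)
    by simp
qed

section \<open>The spaces F_4^k and multiplication by a cube root of unity\<close>

text \<open>The additive group of F_4^k. Finitely supported sequences put all dimensions into one
  type.\<close>

definition bounded_seqs :: "nat \<Rightarrow> (nat \<Rightarrow> 2 \<times> 2) set" where
  "bounded_seqs k = {z. \<forall>i\<ge>k. z i = 0}"

text \<open>
  Multiplication by a primitive cube root of unity of $\mathbb{F}_4 = \mathbb{F}_2[\omega]$,
  where $(p, q)$ stands for $p + q\omega$.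
\<close>
definition omega_mult :: "(nat \<Rightarrow> 2 \<times> 2) \<Rightarrow> nat \<Rightarrow> 2 \<times> 2" where
  "omega_mult z = (\<lambda>i. (snd (z i), fst (z i) + snd (z i)))"

lemma add_self_2 [simp]: "x + x = (0 :: 2)"
proof -
  have "\<forall>x::2. x + x = 0" unfolding all_2 by simp
  then show ?thesis by blast
qed

lemma add_left_self_2 [simp]: "x + (x + y) = (y :: 2)"
  by (simp flip: add.assoc)

lemma add_self_fun [simp]: "z + z = (0 :: nat \<Rightarrow> 2 \<times> 2)"
  by (auto simp: fun_eq_iff plus_prod_def zero_prod_def)

lemma add_self_pair [simp]: "z + z = (0 :: 2 \<times> 2)"
  by (auto simp: plus_prod_def zero_prod_def)

lemma omega_mult_cube: "omega_mult (omega_mult (omega_mult z)) = z"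
  by (auto simp: omega_mult_def fun_eq_iff plus_prod_def prod_eq_iff ac_simps)

lemma add_omega_mult: "z + omega_mult z = omega_mult (omega_mult z)"
  by (auto simp: omega_mult_def fun_eq_iff plus_prod_def prod_eq_iff ac_simps)

lemma omega_mult_mem_iff: "omega_mult z \<in> bounded_seqs k \<longleftrightarrow> z \<in> bounded_seqs k"
  by (auto simp: bounded_seqs_def omega_mult_def zero_prod_def prod_eq_iff)

lemma finite_card_bounded_seqs: "finite (bounded_seqs k) \<and> card (bounded_seqs k) = 4 ^ k"
proof (induction k)
  case 0
  have "bounded_seqs 0 = {0}" by (auto simp: bounded_seqs_def fun_eq_iff)
  then show ?case by simp
next
  case (Suc k)
  have "bij_betw (\<lambda>(z, c). z(k := c)) (bounded_seqs k \<times> UNIV) (bounded_seqs (Suc k))"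
    by (rule bij_betwI[where g = "\<lambda>z. (z(k := 0), z k)"])
      (auto simp: bounded_seqs_def fun_eq_iff not_less_eq_eq le_Suc_eq)
  then have "finite (bounded_seqs (Suc k))"
    "card (bounded_seqs (Suc k)) = card (bounded_seqs k \<times> (UNIV :: (2 \<times> 2) set))"
    using Suc by (auto simp: bij_betw_same_card dest: bij_betw_finite)
  then show ?case using Suc by (simp add: card_cartesian_product)
qed

lemma finite_bounded_seqs: "finite (bounded_seqs k)"
  and card_bounded_seqs: "card (bounded_seqs k) = 4 ^ k"
  using finite_card_bounded_seqs by auto

lemma bounded_seqs_closed:
  "0 \<in> bounded_seqs k"
  "x \<in> bounded_seqs k \<Longrightarrow> y \<in> bounded_seqs k \<Longrightarrow> x + y \<in> bounded_seqs k"
  "x \<in> bounded_seqs k \<Longrightarrow> - x \<in> bounded_seqs k"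
  by (auto simp: bounded_seqs_def)

lemma finite_subgroup_UNIV: "finite_subgroup (UNIV :: 'a::{ab_group_add, finite} set)"
  by (simp add: finite_subgroup_def)

lemma finite_subgroup_torsion: "finite_subgroup {x :: 'a::{ab_group_add, finite}. x + x = 0}"
proof -
  have "(0 :: 'a) + 0 = 0" "finite {x :: 'a. x + x = 0}"
    by simp_all
  moreover have "x + y + (x + y) = 0" if "x + x = 0" "y + y = 0" for x y :: 'a
  proof -
    have "x + y + (x + y) = (x + x) + (y + y)" by (simp only: ac_simps)
    then show ?thesis using that by simp
  qed
  moreover have "- x + - x = 0" if "x + x = 0" for x :: 'a
    using that by (metis minus_add_distrib minus_zero)
  ultimately show ?thesis
    unfolding finite_subgroup_def by blast
qed

lemma finite_subgroup_Times: "finite_subgroup A \<Longrightarrow> finite_subgroup B \<Longrightarrow> finite_subgroup (A \<times> B)"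
  by (auto simp: finite_subgroup_def zero_prod_def)

lemma finite_subgroup_bounded_seqs: "finite_subgroup (bounded_seqs k)"
  by (simp add: finite_subgroup_def finite_bounded_seqs bounded_seqs_closed)

text \<open>Multiplication by omega and by 1 + omega = omega^2 permutes F_4^k, with inverses omega^2
  and omega, so each sum counts a single preimage.\<close>

lemma sum_bounded_seqs_of_bool:
  "(\<Sum>z\<in>bounded_seqs k. of_bool (z = z') :: nat) = of_bool (z' \<in> bounded_seqs k)"
  "(\<Sum>z\<in>bounded_seqs k. of_bool (omega_mult z = z') :: nat) = of_bool (z' \<in> bounded_seqs k)"
  "(\<Sum>z\<in>bounded_seqs k. of_bool (z + omega_mult z = z') :: nat) = of_bool (z' \<in> bounded_seqs k)"
proof -
  have *: "(\<Sum>z\<in>bounded_seqs k. of_bool (z = x) :: nat) = of_bool (x \<in> bounded_seqs k)" for x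
    using finite_bounded_seqs by (simp add: of_bool_def sum.delta)
  have "omega_mult z = z' \<longleftrightarrow> z = omega_mult (omega_mult z')"
    "z + omega_mult z = z' \<longleftrightarrow> z = omega_mult z'" for z
    unfolding add_omega_mult by (metis omega_mult_cube)+
  then show "(\<Sum>z\<in>bounded_seqs k. of_bool (z = z') :: nat) = of_bool (z' \<in> bounded_seqs k)"
    "(\<Sum>z\<in>bounded_seqs k. of_bool (omega_mult z = z') :: nat) = of_bool (z' \<in> bounded_seqs k)"
    "(\<Sum>z\<in>bounded_seqs k. of_bool (z + omega_mult z = z') :: nat) = of_bool (z' \<in> bounded_seqs k)"
    by (simp_all only: * omega_mult_mem_iff)
qed

text \<open>
  The action of $\mathbb{Z}_4$ on an element of order 2.
\<close>
definition parity_scale :: "4 \<Rightarrow> 'a::ab_group_add \<Rightarrow> 'a" where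
  "parity_scale p x = (if p = 1 \<or> p = 3 then x else 0)"

lemma parity_scale_add:
  assumes "x + x = 0"
  shows "parity_scale (p + q) x = parity_scale p x + parity_scale q x"
proof -
  have "\<forall>p q. parity_scale (p + q) x = parity_scale p x + parity_scale q x"
    unfolding all_4 parity_scale_def using assms by simp
  then show ?thesis by blast
qed

lemma parity_scale_in: "finite_subgroup C \<Longrightarrow> x \<in> C \<Longrightarrow> parity_scale p x \<in> C"
  by (simp add: parity_scale_def finite_subgroup_def)

section \<open>Covering a line by Shrikhande graphs and copies of K_4\<close>

lemma card_shrikhande_conn:
  "card {s \<in> shrikhande_conn. P s} = of_bool (P (0,1)) + of_bool (P (0,3)) +
     of_bool (P (1,0)) + of_bool (P (3,0)) + of_bool (P (1,1)) + of_bool (P (3,3))"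
proof -
  have "card {s \<in> shrikhande_conn. P s} = (\<Sum>s\<in>shrikhande_conn. of_bool (P s))"
    by (simp add: shrikhande_conn_def Groups_Big.sum_of_bool_eq Int_def)
  then show ?thesis
    by (simp add: shrikhande_conn_def)
qed

lemma diff_colorable_cong:
  "diff_colorable C \<mu> m n \<Longrightarrow> (\<And>a. \<mu> a = \<mu>' a) \<Longrightarrow> m = m' \<Longrightarrow> n = n' \<Longrightarrow>
     diff_colorable C \<mu>' m' n'"
  by (simp add: ext[of \<mu> \<mu>'])

text \<open>Reduction modulo 2 maps the six connection elements twice onto each nonzero element of
  Z_2^2. One Shrikhande graph thus does the work of two copies of K_4, which is why only
  \<open>2 * m + n\<close> enters.\<close>

lemma diff_colorable_klein:
  assumes "finite_subgroup C" "x \<in> C" "y \<in> C" "x + x = 0" "y + y = 0"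
  shows "diff_colorable C
    (\<lambda>a. (2 * m + n) * (of_bool (a = x) + of_bool (a = y) + of_bool (a = x + y))) m n"
proof -
  have "diff_colorable C
    (\<lambda>a. card {s \<in> shrikhande_conn. parity_scale (fst s) x + parity_scale (snd s) y = a}) 1 0"
  proof (rule diff_colorable_Shrikhande)
    show "parity_scale (fst s) x + parity_scale (snd s) y \<in> C" for s
      using assms parity_scale_in[OF assms(1)] unfolding finite_subgroup_def by blast
    show "parity_scale (fst (s + t)) x + parity_scale (snd (s + t)) y =
      parity_scale (fst s) x + parity_scale (snd s) y +
        (parity_scale (fst t) x + parity_scale (snd t) y)" for s t
      using assms by (simp add: parity_scale_add algebra_simps)
  qed
  then have S: "diff_colorable C
    (\<lambda>a. 2 * (of_bool (a = x) + of_bool (a = y) + of_bool (a = x + y))) 1 0"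
    by (rule diff_colorable_cong) (auto simp: card_shrikhande_conn parity_scale_def)
  show ?thesis
    by (rule diff_colorable_cong[OF diff_colorable_sum[OF assms(1)
        diff_colorable_mult[OF assms(1) S, of m]
        diff_colorable_mult[OF assms(1) diff_colorable_complete[OF assms], of n]]])
      (simp_all add: algebra_simps)
qed

text \<open>Greedy filling. It distributes \<open>a\<close> Shrikhande graphs over the lines, each
  of which has room for at most \<open>k\<close>.\<close>

lemma ex_bounded_sum:
  assumes "finite I" "a \<le> k * card I"
  shows "\<exists>M. (\<forall>i\<in>I. M i \<le> k) \<and> (\<Sum>i\<in>I. M i) = (a::nat)"
  using assms
proof (induction I arbitrary: a rule: finite_induct)
  case empty
  then show ?case by simp
next
  case (insert x F)
  have "a - min a k \<le> k * card F" using insert by auto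
  then obtain M where "\<forall>i\<in>F. M i \<le> k" "(\<Sum>i\<in>F. M i) = a - min a k"
    using insert by blast
  moreover have "(\<Sum>i\<in>F. (M(x := min a k)) i) = (\<Sum>i\<in>F. M i)"
    by (rule sum.cong) (use insert.hyps in auto)
  ultimately have "(\<forall>i\<in>insert x F. (M(x := min a k)) i \<le> k) \<and>
      (\<Sum>i\<in>insert x F. (M(x := min a k)) i) = a"
    using insert.hyps by (simp del: fun_upd_apply add: fun_upd_same) auto
  then show ?case by blast
qed

lemma card_zero_Times_bounded_seqs: "card ({0 :: 'a :: zero} \<times> bounded_seqs k) = 4 ^ k"
  by (simp add: card_cartesian_product card_bounded_seqs)

section \<open>Multiplying the number of colors by 4\<close>

text \<open>The complement of the hyperplane \<open>?B\<close> in F_4^(l+1) is the disjoint union of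
  the nonzero parts of the 4^l lines spanned by the vectors (1, z). The line of \<open>z\<close> is
  covered \<open>g\<close> times by \<open>M z\<close> Shrikhande graphs and
  \<open>g - 2 * M z\<close> copies of K_4; the bound \<open>M z \<le> g div 2\<close> gives the
  bound on \<open>a\<close>.\<close>

lemma balanced_colorable_step_klein:
  assumes "balanced_colorable (4 ^ l) s g m n" "a \<le> (g div 2) * 4 ^ l"
  shows "balanced_colorable (4 ^ Suc l) s g (m + a) (n + (g * 4 ^ l - 2 * a))"
proof -
  let ?C = "(UNIV :: (2 \<times> 2) set) \<times> bounded_seqs l" and ?B = "{0 :: 2 \<times> 2} \<times> bounded_seqs l"
  obtain M where M: "\<And>z. z \<in> bounded_seqs l \<Longrightarrow> M z \<le> g div 2" "(\<Sum>z\<in>bounded_seqs l. M z) = a"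
    using ex_bounded_sum[OF finite_bounded_seqs, of a "g div 2" l] assms(2)
    by (auto simp: card_bounded_seqs)
  have C: "finite_subgroup ?C" and B: "finite_subgroup ?B"
    by (auto simp: finite_subgroup_def finite_bounded_seqs bounded_seqs_closed zero_prod_def)
  \<comment> \<open>The indicator of the nonzero multiples of (1, z): the pairs
    \<open>(1,0)\<close>, \<open>(0,1)\<close> and \<open>(1,1)\<close> encode 1, omega and 1 +
    omega.\<close>
  define \<nu> :: "_ \<Rightarrow> (2 \<times> 2) \<times> (nat \<Rightarrow> 2 \<times> 2) \<Rightarrow> nat" where
    "\<nu> z a = of_bool (a = ((1,0), z)) + of_bool (a = ((0,1), omega_mult z)) +
      of_bool (a = ((1,0), z) + ((0,1), omega_mult z))" for z a
  have "diff_colorable ?C (\<lambda>a. g * \<nu> z a) (M z) (g - 2 * M z)" if z: "z \<in> bounded_seqs l" for z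
  proof -
    have "2 * M z + (g - 2 * M z) = g" using M(1)[OF z] by auto
    moreover have "((1,0), z) \<in> ?C" "((0,1), omega_mult z) \<in> ?C"
      using z by (auto simp: omega_mult_mem_iff)
    moreover have "((1,0), z) + ((1,0), z) = (0 :: (2 \<times> 2) \<times> (nat \<Rightarrow> 2 \<times> 2))"
      "((0,1), omega_mult z) + ((0,1), omega_mult z) = (0 :: (2 \<times> 2) \<times> (nat \<Rightarrow> 2 \<times> 2))"
      by (simp_all add: zero_prod_def)
    ultimately show ?thesis
      using diff_colorable_klein[OF C, of "((1,0), z)" "((0,1), omega_mult z)" "M z" "g - 2 * M z"]
      unfolding \<nu>_def by simp
  qed
  from diff_colorable_sum_set[OF C finite_bounded_seqs this]
  have "diff_colorable ?C (\<lambda>a. \<Sum>z\<in>bounded_seqs l. g * \<nu> z a)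
      (\<Sum>z\<in>bounded_seqs l. M z) (\<Sum>z\<in>bounded_seqs l. g - 2 * M z)"
    by simp
  moreover have "(\<Sum>z\<in>bounded_seqs l. g - 2 * M z) = g * 4 ^ l - 2 * a"
  proof -
    have "(\<Sum>z\<in>bounded_seqs l. g - 2 * M z) =
        (\<Sum>z\<in>bounded_seqs l. g) - (\<Sum>z\<in>bounded_seqs l. 2 * M z)"
      \<comment> \<open>Truncated subtraction commutes with the sum because
        \<open>2 * M z \<le> g\<close> for every \<open>z\<close>.\<close>
      by (rule sum_subtractf_nat) (use M in force)
    then show ?thesis
      using M(2)
      by (simp only: card_bounded_seqs sum_constant flip: sum_distrib_left) (simp add: mult.commute)
  qed
  ultimately have D: "diff_colorable ?C (\<lambda>a. g * (\<Sum>z\<in>bounded_seqs l. \<nu> z a)) a (g * 4 ^ l - 2 * a)"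
    using M by (simp add: sum_distrib_left)
  \<comment> \<open>For nonzero \<open>r\<close> the vector \<open>(r, z')\<close> lies on exactly
    one of the lines, that of z = r^(-1) z'.\<close>
  have \<nu>: "(\<Sum>z\<in>bounded_seqs l. \<nu> z (r, z')) = of_bool (z' \<in> bounded_seqs l \<and> r \<noteq> 0)" for r z'
  proof -
    have "(\<Sum>z\<in>bounded_seqs l. \<nu> z (r, z')) =
        (of_bool (r = (1,0)) + of_bool (r = (0,1)) + of_bool (r = (1,1))) * of_bool (z' \<in> bounded_seqs l)"
      unfolding \<nu>_def
      by (simp add: sum.distrib of_bool_conj eq_commute[of z'] sum_bounded_seqs_of_bool flip: sum_distrib_left)
    moreover have "of_bool (r = (1,0)) + of_bool (r = (0,1)) + of_bool (r = (1,1)) =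
        (of_bool (r \<noteq> 0) :: nat)"
    proof -
      have "\<forall>p q. of_bool ((p,q) = (1,0)) + of_bool ((p,q) = (0,1)) + of_bool ((p,q) = (1::2,1::2)) =
          (of_bool ((p,q) \<noteq> 0) :: nat)"
        unfolding all_2 by (simp add: zero_prod_def)
      then show ?thesis by (cases r) blast
    qed
    ultimately show ?thesis by auto
  qed
  have cover: "g * (\<Sum>z\<in>bounded_seqs l. \<nu> z x) = (if x \<in> ?B then 0 else g)" if x: "x \<in> ?C" for x
  proof -
    obtain r z' where "x = (r, z')" by (rule prod.exhaust)
    with x show ?thesis by (simp only: \<nu> mem_Times_iff fst_conv snd_conv) simp
  qed
  have "?B \<subseteq> ?C" by blast
  moreover have "balanced_colorable (card ?B) s g m n"
    using assms(1) by (simp only: card_zero_Times_bounded_seqs)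
  ultimately have "balanced_colorable (card ?C) s g (m + a) (n + (g * 4 ^ l - 2 * a))"
    using balanced_colorable_extend[OF C B _ _ D cover] by blast
  moreover have "card ?C = 4 ^ Suc l"
    by (simp add: card_cartesian_product card_bounded_seqs)
  ultimately show ?thesis by simp
qed

text \<open>
  As $z$ runs through the sequences, each of $z$, $\omega z$ and $z + \omega z$ runs through them
  once.
\<close>
lemma diff_colorable_shrikhande_hom:
  fixes p :: "4 \<times> 4 \<Rightarrow> 4 \<times> 4"
  assumes "\<And>x y. p (x + y) = p x + p y"
  shows "diff_colorable (UNIV \<times> bounded_seqs k)
    (\<lambda>(r, z'). card {s \<in> shrikhande_conn. p s = r} * of_bool (z' \<in> bounded_seqs k)) (4 ^ k) 0"
proof -
  let ?C = "(UNIV :: (4 \<times> 4) set) \<times> bounded_seqs k"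
  have C: "finite_subgroup ?C" and S: "finite_subgroup (bounded_seqs k)"
    by (auto simp: finite_subgroup_def finite_bounded_seqs bounded_seqs_closed zero_prod_def)
  \<comment> \<open>Every connection element is nonzero modulo 2, so the second component is one of
    z, omega z and z + omega z. Summing over \<open>z\<close> spreads \<open>p s\<close> evenly over
    all second components.\<close>
  define h where "h z s = (p s, parity_scale (fst s) z + parity_scale (snd s) (omega_mult z))"
    for z s
  have "diff_colorable ?C (\<lambda>a. card {s \<in> shrikhande_conn. h z s = a}) 1 0"
    if "z \<in> bounded_seqs k" for z
  proof (rule diff_colorable_Shrikhande)
    show "h z s \<in> ?C" for s
      using that
      by (auto simp: h_def omega_mult_mem_iff intro!: bounded_seqs_closed parity_scale_in[OF S])
    show "h z (s + t) = h z s + h z t" for s t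
      using assms by (simp add: h_def parity_scale_add algebra_simps)
  qed
  from diff_colorable_sum_set[OF C finite_bounded_seqs this]
  have "diff_colorable ?C (\<lambda>a. \<Sum>z\<in>bounded_seqs k. card {s \<in> shrikhande_conn. h z s = a})
    (4 ^ k) 0"
    by (simp add: card_bounded_seqs)
  then show ?thesis
    by (rule diff_colorable_cong)
      (auto simp: card_shrikhande_conn h_def parity_scale_def sum.distrib of_bool_conj
        sum_bounded_seqs_of_bool algebra_simps simp flip: sum_distrib_left)
qed

text \<open>Here \<open>?B\<close> is the 2-torsion of Z_4^2 \<times> F_4^k and has index 4. Two
  homomorphisms on Z_4^2, each twisted by all 4^k sequences, cover the complement once using
  Shrikhande graphs only, so the number of K_4 factors does not grow.\<close>

lemma balanced_colorable_step_shrikhande: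
  assumes "balanced_colorable (4 ^ Suc k) s g m n"
  shows "balanced_colorable (4 ^ Suc (Suc k)) s g (m + 2 * g * 4 ^ k) n"
proof -
  let ?C = "(UNIV :: (4 \<times> 4) set) \<times> bounded_seqs k"
    and ?B = "{r :: 4 \<times> 4. r + r = 0} \<times> bounded_seqs k"
  have C: "finite_subgroup ?C" and B: "finite_subgroup ?B"
    by (intro finite_subgroup_Times finite_subgroup_UNIV finite_subgroup_torsion
        finite_subgroup_bounded_seqs)+
  \<comment> \<open>The 12 elements of order 4 in $\mathbb{Z}_4^2$ are the connection set and its image
    under $t$.\<close>
  define t :: "4 \<times> 4 \<Rightarrow> 4 \<times> 4" where "t = (\<lambda>(p, q). (p + q, 2 * p + 3 * q))"
  have t_add: "t (x + y) = t x + t y" for x y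
    by (cases x; cases y) (simp add: t_def algebra_simps)
  have D: "diff_colorable ?C (\<lambda>a. g * of_bool (a \<in> ?C \<and> a \<notin> ?B)) (2 * g * 4 ^ k) 0"
  proof (rule diff_colorable_cong[OF diff_colorable_mult[OF C diff_colorable_sum[OF C
          diff_colorable_shrikhande_hom[of "\<lambda>s. s", OF refl]
          diff_colorable_shrikhande_hom[of t, OF t_add]], of g]])
    fix a :: "(4 \<times> 4) \<times> (nat \<Rightarrow> 2 \<times> 2)"
    obtain p q z where a: "a = ((p, q), z)" by (metis surj_pair)
    have "\<forall>p q.
      card {s \<in> shrikhande_conn. s = (p, q)} + card {s \<in> shrikhande_conn. t s = (p, q)} =
      of_bool (\<not> (p + p = 0 \<and> q + q = 0))"
      unfolding all_4 card_shrikhande_conn t_def by simp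
    from this[rule_format, of p q]
    show "g * ((case a of (r, z') \<Rightarrow>
          card {s \<in> shrikhande_conn. s = r} * of_bool (z' \<in> bounded_seqs k)) +
        (case a of (r, z') \<Rightarrow>
          card {s \<in> shrikhande_conn. t s = r} * of_bool (z' \<in> bounded_seqs k))) =
      g * of_bool (a \<in> ?C \<and> a \<notin> ?B)"
      unfolding a by (cases "z \<in> bounded_seqs k") (simp_all add: zero_prod_def)
  qed simp_all
  have "card {r :: 4 \<times> 4. r + r = 0} = 4"
  proof -
    have "\<forall>(p::4) (q::4). (p,q) + (p,q) = 0 \<longleftrightarrow> (p,q) \<in> {(0,0),(0,2),(2,0),(2,2)}"
      unfolding all_4 by (simp add: zero_prod_def)
    then have "r + r = 0 \<longleftrightarrow> r \<in> {(0,0),(0,2),(2,0),(2,2)}" for r :: "4 \<times> 4"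
      by (cases r) blast
    then have "{r :: 4 \<times> 4. r + r = 0} = {(0,0),(0,2),(2,0),(2,2)}"
      by (simp only: Collect_mem_eq)
    then show ?thesis by simp
  qed
  then have cB: "card ?B = 4 ^ Suc k" by (simp add: card_cartesian_product card_bounded_seqs)
  have "?B \<subseteq> ?C" by blast
  moreover have "balanced_colorable (card ?B) s g m n"
    using assms(1) by (simp only: cB)
  moreover have "g * of_bool (x \<in> ?C \<and> x \<notin> ?B) = (if x \<in> ?B then 0 else g)" if "x \<in> ?C" for x
    using that by simp
  ultimately have "balanced_colorable (card ?C) s g (m + 2 * g * 4 ^ k) (n + 0)"
    using balanced_colorable_extend[OF C B _ _ D] by blast
  moreover have "card ?C = 4 ^ Suc (Suc k)"
    by (simp add: card_cartesian_product card_bounded_seqs)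
  ultimately show ?thesis by simp
qed

section \<open>Adding colorings, the nonlinear 4-coloring, and iteration of the steps\<close>

text \<open>Both colorings are transported to the same group F_4^l, where the sum of colorings adds
  the multiplicities.\<close>

lemma balanced_colorable_add:
  assumes "balanced_colorable (4 ^ l) s g m n" "balanced_colorable (4 ^ l) s' g' m' n'"
  shows "balanced_colorable (4 ^ l) (s + s') (g + g') (m + m') (n + n')"
proof -
  have S: "finite_subgroup (bounded_seqs l)" by (rule finite_subgroup_bounded_seqs)
  have "diff_colorable (bounded_seqs l)
      (\<lambda>a. if a = 0 then s else if a \<in> bounded_seqs l then g else 0) m n"
    "diff_colorable (bounded_seqs l)
      (\<lambda>a. if a = 0 then s' else if a \<in> bounded_seqs l then g' else 0) m' n'"
    using balanced_imp_diff_colorable[OF S _ subset_refl] assms unfolding card_bounded_seqs by blast+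
  from diff_imp_balanced_colorable[OF S diff_colorable_sum[OF S this] refl, of "g + g'"]
  show ?thesis by (simp add: card_bounded_seqs)
qed

text \<open>
  The two bits of the color and their sum are signs whose restrictions to the two Shrikhande graphs
  are eigenfunctions with eigenvalues $2$ and $-2$, so each has eigenvalue $0$ on the product.
\<close>
lemma balanced_colorable_3_3: "balanced_colorable 4 3 3 2 0"
proof -
  \<comment> \<open>The low and the high binary digit of an element of Z_4. The high digit is not
    additive, which makes the coloring nonlinear.\<close>
  define od up :: "4 \<Rightarrow> bool" where "od p \<longleftrightarrow> p = 1 \<or> p = 3" and "up p \<longleftrightarrow> p = 2 \<or> p = 3" for p
  define c where "c x1 x2 y2 = 2 * of_bool (up x1 \<noteq> od y2) + (of_bool (od x1 \<noteq> up x2) :: nat)"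
    for x1 x2 y2
  define f :: "(4 \<times> 4) list \<times> 4 list \<Rightarrow> nat" where
    "f u = c (fst (fst u ! 0)) (fst (fst u ! 1)) (snd (fst u ! 1))" for u
  have f: "f (join ([r], []) ([s], [])) = c (fst r) (fst s) (snd s)" for r s
    by (simp add: f_def join_def)
  \<comment> \<open>The color ignores the second coordinate in the first graph, so the six moves
    there shift \<open>x1\<close> by 0, 1 and 3, each twice. The remaining six terms are the moves
    in the second graph.\<close>
  have check: "\<forall>x1 x2 y2. \<forall>j\<in>{0,1,2,3}.
    2 * of_bool (c x1 x2 y2 = j) + 2 * of_bool (c (x1 + 1) x2 y2 = j) +
    2 * of_bool (c (x1 + 3) x2 y2 = j)
    + (of_bool (c x1 x2 (y2 + 1) = j) + of_bool (c x1 x2 (y2 + 3) = j) +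
      of_bool (c x1 (x2 + 1) y2 = j) + of_bool (c x1 (x2 + 3) y2 = j) +
      of_bool (c x1 (x2 + 1) (y2 + 1) = j) + of_bool (c x1 (x2 + 3) (y2 + 3) = j)) = (3::nat)"
    unfolding all_4 c_def od_def up_def by simp
  show ?thesis
    unfolding balanced_colorable_def
  proof (intro exI[of _ f] ballI conjI allI impI)
    fix v :: "(4 \<times> 4) list \<times> 4 list" and j :: nat assume "v \<in> D_verts 2 0"
    then have "v \<in> D_verts (1 + 1) (0 + 0)" by (simp add: numeral_2_eq_2)
    then obtain v1 v2 where "v1 \<in> D_verts 1 0" "v2 \<in> D_verts 1 0" "v = join v1 v2"
      by (rule join_exhaust)
    then obtain x1 y1 x2 y2 where v: "v = join ([(x1,y1)], []) ([(x2,y2)], [])"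
      by (cases v1; cases v2) (auto simp: D_verts_def length_Suc_conv)
    have D: "([(x1,y1)], []) \<in> D_verts 1 0" "([(x2,y2)], []) \<in> D_verts 1 0"
      by (auto simp: D_verts_def)
    show "f v < 4" by (simp add: v f c_def)
    assume "j < 4"
    then have j: "j \<in> {0,1,2,3}" by auto
    show "card {w. D_adj v w \<and> f w = j} = (if j = f v then 3 else 3)"
      unfolding v card_D_adj_join[OF D] card_D_adj_Shrikhande f card_shrikhande_conn
      using check[rule_format, OF j, of x1 x2 y2] by simp
  qed
qed

lemma three_sum_pow4: "3 * (\<Sum>i<l. 4 ^ i) + 1 = (4 :: nat) ^ l"
  by (induction l) auto

text \<open>Iterates the line step, starting from one color on a one-vertex graph. The sum of the
  4^i counts all lines used, each with room for \<open>g div 2\<close> Shrikhande graphs.\<close>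

lemma balanced_colorable_klein:
  assumes "a \<le> (g div 2) * (\<Sum>i<l. 4 ^ i)"
  shows "balanced_colorable (4 ^ l) 0 g a (g * (\<Sum>i<l. 4 ^ i) - 2 * a)"
  using assms
proof (induction l arbitrary: a)
  case 0
  then show ?case by (auto simp: balanced_colorable_def D_verts_0 D_adj_Nil)
next
  case (Suc l)
  define N :: nat where "N = (\<Sum>i<l. 4 ^ i)"
  \<comment> \<open>The lower levels are filled to capacity first; the rest goes to the lines of the
    last level.\<close>
  define a1 where "a1 = min a ((g div 2) * N)"
  have a: "a \<le> g div 2 * N + g div 2 * 4 ^ l"
    using Suc.prems by (simp add: N_def algebra_simps)
  have a1: "a1 \<le> g div 2 * N" "a1 \<le> a" "a - a1 \<le> g div 2 * 4 ^ l"
    using a by (auto simp: a1_def min_def)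
  have *: "balanced_colorable (4 ^ Suc l) 0 g (a1 + (a - a1))
    (g * N - 2 * a1 + (g * 4 ^ l - 2 * (a - a1)))"
    by (rule balanced_colorable_step_klein[OF Suc.IH[of a1, folded N_def]]) (use a1 in auto)
  \<comment> \<open>Guarantees that none of the truncated subtractions below cuts off.\<close>
  have g: "2 * (g div 2 * x) \<le> g * x" for x
    by (metis mult.assoc mult_le_mono1 times_div_less_eq_dividend)
  have "g * N - 2 * a1 + (g * 4 ^ l - 2 * (a - a1)) = g * (N + 4 ^ l) - 2 * a"
    using a1 g[of N] g[of "4 ^ l"] unfolding distrib_left by linarith
  then show ?case using * a1 by (simp add: N_def)
qed

text \<open>Beyond four colors only Shrikhande graphs are added, so the number \<open>n\<close> of
  K_4 factors is decided by the 4-coloring.\<close>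

lemma balanced_colorable_shrikhande_steps:
  assumes "balanced_colorable 4 s g m n"
  shows "balanced_colorable (4 ^ Suc k) s g (m + 2 * g * (\<Sum>i<k. 4 ^ i)) n"
proof (induction k)
  case 0
  then show ?case using assms by simp
next
  case (Suc k)
  then show ?case using balanced_colorable_step_shrikhande[OF Suc] by (simp add: algebra_simps)
qed

section \<open>Merging colors into a perfect 2-coloring\<close>

text \<open>Merge \<open>p\<close> colors into color 1 and \<open>q\<close> into color 2. A vertex
  sees its own old color \<open>s\<close> times and every other one \<open>g\<close> times, so the
  count for its own block falls short of the full multiple of \<open>g\<close> by
  \<open>g - s\<close>.\<close>

lemma perfect_coloring_of_balanced:
  assumes "balanced_colorable (p + q) s g m n" "p > 0" "q > 0" "g > 0"
  shows "\<exists>f :: _ \<Rightarrow> 2. perfect_coloring (D_verts m n) D_adj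
    (vector [vector [int (p * g) - int g + int s, int (q * g)],
             vector [int (p * g), int (q * g) - int g + int s]]) f"
proof -
  obtain F where F: "\<And>v. v \<in> D_verts m n \<Longrightarrow> F v < p + q"
    "\<And>v j. v \<in> D_verts m n \<Longrightarrow> j < p + q \<Longrightarrow>
       card {w. D_adj v w \<and> F w = j} = (if j = F v then s else g)"
    using assms unfolding balanced_colorable_def by fast
  define f :: "_ \<Rightarrow> 2" where "f v = (if F v < p then 1 else 2)" for v
  have block: "card {w. D_adj v w \<and> F w \<in> J} =
      (if F v \<in> J then s + (card J - 1) * g else card J * g)"
    if v: "v \<in> D_verts m n" and J: "J \<subseteq> {..<p + q}" for v J
  proof -
    have fin: "finite J" using J finite_subset by blast
    have "{w. D_adj v w \<and> F w \<in> J} = (\<Union>j\<in>J. {w. D_adj v w \<and> F w = j})"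
      by auto
    also have "card \<dots> = (\<Sum>j\<in>J. card {w. D_adj v w \<and> F w = j})"
      by (rule card_UN_disjoint) (auto simp: fin finite_D_adj)
    also have "\<dots> = (\<Sum>j\<in>J. if j = F v then s else g)"
      using F(2)[OF v] J by (intro sum.cong) auto
    also have "\<dots> = (if F v \<in> J then s + (card J - 1) * g else card J * g)"
    proof (cases "F v \<in> J")
      case True
      then have "(\<Sum>j\<in>J. if j = F v then s else g) = s + (\<Sum>j\<in>J - {F v}. if j = F v then s else g)"
        using fin by (simp add: sum.remove)
      also have "(\<Sum>j\<in>J - {F v}. if j = F v then s else g) = (\<Sum>j\<in>J - {F v}. g)"
        by (rule sum.cong) auto
      finally show ?thesis using True fin by simp
    next
      case False
      then have "(\<Sum>j\<in>J. if j = F v then s else g) = (\<Sum>j\<in>J. g)"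
        by (intro sum.cong) auto
      then show ?thesis using False by simp
    qed
    finally show ?thesis .
  qed
  have two: "(1::2) \<noteq> 2" "(2::2) \<noteq> 1" by simp_all
  have count: "card {w \<in> D_verts m n. D_adj v w \<and> f w = 1} =
        (if F v < p then s + (p - 1) * g else p * g)"
      "card {w \<in> D_verts m n. D_adj v w \<and> f w = 2} =
        (if F v < p then q * g else s + (q - 1) * g)"
    if v: "v \<in> D_verts m n" for v
  proof -
    have "{w \<in> D_verts m n. D_adj v w \<and> f w = 1} = {w. D_adj v w \<and> F w \<in> {..<p}}"
      "{w \<in> D_verts m n. D_adj v w \<and> f w = 2} = {w. D_adj v w \<and> F w \<in> {p..<p+q}}"
      using D_adj_verts[of v _ m n] v F(1) two by (auto simp: f_def split: if_splits)
    moreover have "{p..<p+q} \<subseteq> {..<p+q}" by auto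
    ultimately show "card {w \<in> D_verts m n. D_adj v w \<and> f w = 1} =
        (if F v < p then s + (p - 1) * g else p * g)"
      "card {w \<in> D_verts m n. D_adj v w \<and> f w = 2} =
        (if F v < p then q * g else s + (q - 1) * g)"
      using block[OF v, of "{..<p}"] block[OF v, of "{p..<p+q}"] F(1)[OF v] by auto
  qed
  have pos: "int (p - Suc 0) = int p - 1" "int (q - Suc 0) = int q - 1"
    using assms by auto
  \<comment> \<open>Both colors occur: a vertex in one block has \<open>p * g\<close> or
    \<open>q * g\<close> neighbours in the other, and both numbers are positive.\<close>
  have surj: "f ` D_verts m n = UNIV"
  proof -
    obtain v where v: "v \<in> D_verts m n" using D_verts_nonempty by blast
    have "\<exists>w\<in>D_verts m n. f w = 1"
    proof (cases "F v < p")
      case True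
      then show ?thesis using v by (auto simp: f_def)
    next
      case False
      then have "card {w \<in> D_verts m n. D_adj v w \<and> f w = 1} \<noteq> 0"
        using count(1)[OF v] assms by simp
      then show ?thesis by (metis (mono_tags, lifting) card.empty empty_Collect_eq)
    qed
    moreover have "\<exists>w\<in>D_verts m n. f w = 2"
    proof (cases "F v < p")
      case False
      then show ?thesis using v by (auto simp: f_def)
    next
      case True
      then have "card {w \<in> D_verts m n. D_adj v w \<and> f w = 2} \<noteq> 0"
        using count(2)[OF v] assms by simp
      then show ?thesis by (metis (mono_tags, lifting) card.empty empty_Collect_eq)
    qed
    ultimately show ?thesis
      using exhaust_2 by (auto simp: image_iff) metis
  qed
  show ?thesis
    unfolding perfect_coloring_def
  proof (intro exI[of _ f] conjI ballI surj)
    fix v assume v: "v \<in> D_verts m n"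
    show "\<forall>j. int (card {w \<in> D_verts m n. D_adj v w \<and> f w = j}) =
      vector [vector [int (p * g) - int g + int s, int (q * g)],
             vector [int (p * g), int (q * g) - int g + int s]] $ f v $ j"
      unfolding forall_2 count[OF v]
      by (simp add: f_def pos) (simp add: algebra_simps)
  qed
qed

theorem theorem4:
  fixes b c g l :: nat
  assumes "b > 0" and "c > 0"
    and "g = gcd b c" and "g \<ge> 2"
    and "l > 0" and "(b + c) div g = 4 ^ l"
  shows "(\<forall>m n. 2 * m + n = g * (4 ^ l - 1) div 3 \<longrightarrow>
            (\<exists>f :: (4 \<times> 4) list \<times> 4 list \<Rightarrow> 2. perfect_coloring (D_verts m n) D_adj
               (vector [vector [int c - int g, int b],
                        vector [int c, int b - int g]]) f))
       \<and> (odd g \<longrightarrow> (\<forall>m. 2 * m = (g * (4 ^ l - 1) + 3) div 3 \<longrightarrow>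
            (\<exists>f :: (4 \<times> 4) list \<times> 4 list \<Rightarrow> 2. perfect_coloring (D_verts m 0) D_adj
               (vector [vector [int c - int g + 3, int b],
                        vector [int c, int b - int g + 3]]) f)))"
proof -
  \<comment> \<open>Color 1 will consist of c/g and color 2 of b/g of the 4^l colors.\<close>
  obtain p q where pq: "c = p * g" "b = q * g"
    using assms(3) by (metis dvd_div_mult_self gcd_dvd1 gcd_dvd2)
  have pos: "p > 0" "q > 0" "g > 0"
    using pq assms(1,2,4) by (auto intro!: gr0I)
  have "b + c = (p + q) * g" using pq by (simp add: algebra_simps)
  then have "p + q = 4 ^ l"
    using assms(6) pos by simp
  then have color: "\<exists>f :: _ \<Rightarrow> 2. perfect_coloring (D_verts m n) D_adj
    (vector [vector [int c - int g + int s, int b],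
             vector [int c, int b - int g + int s]]) f"
    if "balanced_colorable (4 ^ l) s g m n" for s m n
    using perfect_coloring_of_balanced[of p q s g m n] that pos pq by simp
  define N :: nat where "N = (\<Sum>i<l. 4 ^ i)"
  have N: "4 ^ l - 1 = 3 * N"
    using three_sum_pow4[of l] by (simp add: N_def)
  obtain k where k: "l = Suc k" using assms(5) gr0_implies_Suc by blast
  \<comment> \<open>The number of Shrikhande graphs used for multiplicity 1 when just one K_4 is
    kept; \<open>N\<close> is odd, so one K_4 has to remain in that case.\<close>
  define T :: nat where "T = 2 * (\<Sum>i<k. 4 ^ i)"
  have NT: "N = 2 * T + 1"
    using three_sum_pow4[of k] by (simp add: N_def T_def k)
  have klein: "balanced_colorable (4 ^ l) 0 h a (h * N - 2 * a)" if "a \<le> h div 2 * N" for a h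
    using balanced_colorable_klein that by (simp add: N_def)
  have part1: "balanced_colorable (4 ^ l) 0 g m n" if mn: "2 * m + n = g * N" for m n
  \<comment> \<open>Lines alone have room for \<open>g div 2 * N\<close> Shrikhande graphs. For even
    \<open>g\<close> this is always enough.\<close>
  proof (cases "m \<le> g div 2 * N")
    case True
    from klein[OF this] show ?thesis using mn by (metis add_diff_cancel_left')
  next
    case False
    have "odd g"
    proof
      assume "even g"
      then have "2 * (g div 2 * N) = g * N" by auto
      then show False using False mn by linarith
    qed
    then obtain h where h: "g = 2 * h + 1" by (rule oddE)
    \<comment> \<open>Since \<open>g\<close> is odd and at least 2, \<open>h\<close> is positive.
      Hence \<open>m\<close> exceeds \<open>N\<close> and in particular \<open>T\<close>, so
      \<open>m - T\<close> below is a true difference.\<close>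
    have hN: "N \<le> h * N" using assms(4) h by simp
    have m: "h * N < m" "2 * m + n = 2 * (h * N) + N"
      using False mn h by (auto simp: algebra_simps)
    \<comment> \<open>Multiplicity 1 comes from one K_4 with four distinct colors, extended by
      \<open>T\<close> Shrikhande graphs. Lines supply the remaining multiplicity
      \<open>2 * h\<close> with \<open>m - T\<close> Shrikhande graphs.\<close>
    have "balanced_colorable 4 0 1 0 1"
      using balanced_colorable_klein[of 0 1 1] by simp
    from balanced_colorable_shrikhande_steps[OF this, of k]
    have 1: "balanced_colorable (4 ^ l) 0 1 T 1"
      by (simp add: k T_def)
    have "m - T \<le> (2 * h) div 2 * N"
      using m NT by simp
    from balanced_colorable_add[OF 1 klein[OF this]]
    have "balanced_colorable (4 ^ l) 0 g (T + (m - T)) (1 + (2 * h * N - 2 * (m - T)))"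
      by (simp add: h)
    moreover have "T \<le> m" "m \<le> h * N + T"
      using m hN NT by linarith+
    then have "T + (m - T) = m" "1 + (2 * h * N - 2 * (m - T)) = n"
      using m(2) NT unfolding mult.assoc by linarith+
    ultimately show ?thesis by simp
  qed
  have part2: "balanced_colorable (4 ^ l) 3 g m 0" if m: "2 * m = g * N + 1" and g: "odd g" for m
  proof -
    obtain h where h: "g = 2 * h + 1" using g by (rule oddE)
    then have "h > 0" using assms(4) by simp
    \<comment> \<open>Writing g = 3 + 2 i, two Shrikhande graphs with the nonlinear coloring give
      multiplicity 3 and diagonal entry 3 on four colors, and \<open>i\<close> further ones give
      multiplicity \<open>2 * i\<close> with diagonal entry 0.\<close>
    then obtain i where i: "h = Suc i" using gr0_implies_Suc by blast
    have "balanced_colorable (4 ^ 1) 0 (2 * i) i 0"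
      using balanced_colorable_klein[of i "2 * i" 1] by simp
    then have "balanced_colorable (4 ^ 1) (3 + 0) (3 + 2 * i) (2 + i) (0 + 0)"
      using balanced_colorable_3_3 by (intro balanced_colorable_add) simp_all
    moreover have "3 + 2 * i = g" by (simp add: h i)
    ultimately have "balanced_colorable 4 3 g (2 + i) 0" by simp
    from balanced_colorable_shrikhande_steps[OF this, of k]
    have "balanced_colorable (4 ^ l) 3 g (2 + i + g * T) 0"
      by (simp add: k T_def mult.assoc mult.left_commute)
    moreover have "2 * m = 2 * (2 + i + g * T)"
      using m by (simp add: NT h i algebra_simps)
    then have "m = 2 + i + g * T"
      by (simp only: mult_cancel_left) simp
    ultimately show ?thesis by simp
  qed
  have "g * (4 ^ l - 1) div 3 = g * N" "(g * (4 ^ l - 1) + 3) div 3 = g * N + 1"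
    unfolding N by (simp_all add: mult.left_commute)
  then show ?thesis
    using color[of 0] color[of 3] part1 part2 by simp
qed

end
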